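(* For any abstract graph $G$ and any Hamiltonian graph $H$: (1) $\theta(G)\le \ell(G)$; (2) $\mathrm{bt}(H)\le h\ell(H)$.
   Context: All graphs are connected, undirected, simple and finite. A graph is Hamiltonian if it contains a cycle that visits every vertex exactly once. The graph-theoretical thickness $\theta(G)$ is the minimum number of planar subgraphs whose union is $G$. For $n\ge1$, an $n$-book consists of a line $L$ (the spine of the book) and $n$ distinct half-planes (pages) with boundary $L$; an $n$-book embedding of $G$ is an embedding of $G$ in an $n$-book such that each vertex lies on $L$ and each edge lies in the interior of one page. The book thickness $\mathrm{bt}(G)$ is the smallest $n$ such that $G$ has an $n$-book embedding. A graph embedding is an embedding $G\to S^3$, up to ambient isotopy; the spatial graph $\mathcal{G}$ is its image up to ambient isotopy. Everything is tame (piecewise linear). A cycle is unknotted if it can be embedded as the equator of a sphere $S^2$. The fragments of a graph $G$ with respect to a cycle $C$ are the closures of the connected components of $G-C$ (topologically; so an edge not in $C$ with both endpoints on $C$ is a fragment). A diagram of $\mathcal{G}$ is the image of a projection of $\mathcal{G}$ to $\mathbb{R}^2$ such that all intersections are transversal, no vertices and at most two points are mapped to a crossing, and at each double point over/under information is assigned. It is reduced if no Reidemeister moves of type 1 and 2 can be applied to reduce its number of crossings. $\mathcal{G}$ is semi-leveled if there is an unknotted cycle $C$ (the spine) and a diagram $D$ of $\mathcal{G}$ (a semi-leveled diagram) in which no fragment with respect to $C$ has self-crossings, crossings with $C$, or both over- and under-crossings with another fragment. A reduced semi-leveled diagram in which every fragment lies in the bounded connected component of $\mathbb{R}^2\setminus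 C$ is divided in levels if there is a partition $\{L_1,\dots,L_n\}$ of all the fragments such that $L_1$ is the set of fragments that do not cross over any other fragment, and for $i>1$ the set $L_i$ consists of the fragments that cross over at least one fragment in $L_{i-1}$ and only cross over fragments in sets $L_k$ with $k<i$; then $n$ is the number of levels. A connected spatial graph is leveled (with spine $C$) if it has a semi-leveled diagram (with spine $C$) that is divided in levels; it is Hamiltonian leveled if the spine is a Hamiltonian cycle of the underlying graph. The level number $\ell(\mathcal{G})$ of a spatial graph is the minimum number of levels ranging over all possible spines, with $\ell(\mathcal{G})=\infty$ if $\mathcal{G}$ admits no leveled embedding; $\ell(G)$ of an abstract graph is the minimum of $\ell(\mathcal{G})$ over all embeddings of $G$. The Hamiltonian level number $h\ell(\mathcal{G})$ is the minimum number of levels ranging over all choices of Hamiltonian spines for a Hamiltonian leveled embedding of $\mathcal{G}$; $h\ell(H)$ of an abstract Hamiltonian graph is the minimum over all its embeddings. Convention here: a leveled embedding consisting of the spine only (no fragments) is counted as having one level. *)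

theory Defs
  imports "HOL-Analysis.Analysis"
begin

record 'v ugraph =
  verts :: "'v set"
  edges :: "'v set set"

definition simple_graph :: "'v ugraph \<Rightarrow> bool" where
  "simple_graph G \<longleftrightarrow> finite (verts G) \<and> verts G \<noteq> {} \<and>
     (\<forall>e\<in>edges G. e \<subseteq> verts G \<and> card e = 2)"

definition connected_graph :: "'v ugraph \<Rightarrow> bool" where
  "connected_graph G \<longleftrightarrow>
     (\<forall>u\<in>verts G. \<forall>v\<in>verts G. (u, v) \<in> {(x, y). {x, y} \<in> edges G}\<^sup>*)"

text \<open>A cycle is given by the list of its vertices in cyclic order.\<close>

definition cycle_edges :: "'v list \<Rightarrow> 'v set set" where
  "cycle_edges c = {{c ! i, c ! (Suc i mod length c)} | i. i < length c}"

definition is_cycle :: "'v ugraph \<Rightarrow> 'v list \<Rightarrow> bool" where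
  "is_cycle G c \<longleftrightarrow> 3 \<le> length c \<and> distinct c \<and> set c \<subseteq> verts G \<and> cycle_edges c \<subseteq> edges G"

definition is_hamiltonian_cycle :: "'v ugraph \<Rightarrow> 'v list \<Rightarrow> bool" where
  "is_hamiltonian_cycle G c \<longleftrightarrow> is_cycle G c \<and> set c = verts G"

definition hamiltonian_graph :: "'v ugraph \<Rightarrow> bool" where
  "hamiltonian_graph G \<longleftrightarrow> (\<exists>c. is_hamiltonian_cycle G c)"

definition is_subgraph :: "'v ugraph \<Rightarrow> 'v ugraph \<Rightarrow> bool" where
  "is_subgraph S G \<longleftrightarrow> verts S \<subseteq> verts G \<and> edges S \<subseteq> edges G \<and> (\<forall>e\<in>edges S. e \<subseteq> verts S)"

text \<open>A drawing assigns a point to every vertex and a path to every edge.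
  Values outside the graph are irrelevant.\<close>

record ('v, 'p) drawing =
  vpoint :: "'v \<Rightarrow> 'p"
  epath :: "'v set \<Rightarrow> real \<Rightarrow> 'p"

definition eimage :: "('v, 'p::topological_space) drawing \<Rightarrow> 'v set \<Rightarrow> 'p set" where
  "eimage D e = path_image (epath D e)"

definition graph_image :: "'v ugraph \<Rightarrow> ('v, 'p::topological_space) drawing \<Rightarrow> 'p set" where
  "graph_image G D = vpoint D ` verts G \<union> (\<Union>e\<in>edges G. eimage D e)"

definition embeds_in ::
    "'v ugraph \<Rightarrow> 'p::topological_space set \<Rightarrow> ('v, 'p) drawing \<Rightarrow> bool" where
  "embeds_in G X D \<longleftrightarrow>
     graph_image G D \<subseteq> X \<and>
     inj_on (vpoint D) (verts G) \<and>
     (\<forall>e\<in>edges G. arc (epath D e) \<and>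
        {pathstart (epath D e), pathfinish (epath D e)} = vpoint D ` e \<and>
        eimage D e \<inter> vpoint D ` verts G = vpoint D ` e) \<and>
     (\<forall>e\<in>edges G. \<forall>e'\<in>edges G. e \<noteq> e' \<longrightarrow> eimage D e \<inter> eimage D e' = vpoint D ` (e \<inter> e'))"

text \<open>Minima are infima in \<^typ>\<open>enat\<close>; the infimum of a nonempty set is attained, and the
  infimum of the empty set is \<open>\<infinity>\<close>.\<close>

definition planar_graph :: "'v ugraph \<Rightarrow> bool" where
  "planar_graph G \<longleftrightarrow> (\<exists>D :: ('v, real^2) drawing. embeds_in G UNIV D)"

definition thickness :: "'v ugraph \<Rightarrow> enat" where
  "thickness G = Inf {enat n | n. \<exists>S :: nat \<Rightarrow> 'v ugraph.
     (\<forall>i<n. is_subgraph (S i) G \<and> planar_graph (S i)) \<and>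
     (\<Union>i<n. verts (S i)) = verts G \<and> (\<Union>i<n. edges (S i)) = edges G}"

definition is_line :: "(real^3) set \<Rightarrow> bool" where
  "is_line L \<longleftrightarrow> (\<exists>p d. d \<noteq> 0 \<and> L = {p + t *\<^sub>R d | t. True})"

definition half_plane_with_boundary :: "(real^3) set \<Rightarrow> (real^3) set \<Rightarrow> bool" where
  "half_plane_with_boundary P L \<longleftrightarrow>
     (\<exists>p d u. \<not> collinear {0, d, u} \<and> L = {p + t *\<^sub>R d | t. True} \<and>
        P = {p + t *\<^sub>R d + s *\<^sub>R u | t s. 0 \<le> s})"

definition is_book :: "nat \<Rightarrow> (real^3) set \<Rightarrow> (real^3) set set \<Rightarrow> bool" where
  "is_book n L Ps \<longleftrightarrow> 1 \<le> n \<and> is_line L \<and> finite Ps \<and> card Ps = n \<and>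
     (\<forall>P\<in>Ps. half_plane_with_boundary P L)"

definition book_embedding ::
    "'v ugraph \<Rightarrow> (real^3) set \<Rightarrow> (real^3) set set \<Rightarrow> ('v, real^3) drawing \<Rightarrow> bool" where
  "book_embedding G L Ps D \<longleftrightarrow> embeds_in G (L \<union> \<Union>Ps) D \<and> vpoint D ` verts G \<subseteq> L \<and>
     (\<forall>e\<in>edges G. \<exists>P\<in>Ps. eimage D e - vpoint D ` e \<subseteq> rel_interior P)"

definition book_thickness :: "'v ugraph \<Rightarrow> enat" where
  "book_thickness G = Inf {enat n | n. \<exists>L Ps D. is_book n L Ps \<and> book_embedding G L Ps D}"

text \<open>Three-space is \<open>\<real>\<^sup>2 \<times> \<real>\<close>, so that \<^const>\<open>fst\<close> is the projection to the plane and
  \<^const>\<open>snd\<close> is the height; \<open>S\<^sup>3\<close> is the unit sphere of \<open>\<real>\<^sup>3 \<times> \<real>\<close>.\<close>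

type_synonym plane = "real^2"
type_synonym space3 = "plane \<times> real"
type_synonym space4 = "space3 \<times> real"

definition S3 :: "space4 set" where
  "S3 = sphere 0 1"

text \<open>Inverse of the stereographic projection from the pole \<open>(0, 1)\<close>; it identifies
  \<open>\<real>\<^sup>3\<close> with the complement of the pole in \<open>S\<^sup>3\<close>.\<close>

definition to_S3 :: "space3 \<Rightarrow> space4" where
  "to_S3 x = ((2 / ((norm x)\<^sup>2 + 1)) *\<^sub>R x, ((norm x)\<^sup>2 - 1) / ((norm x)\<^sup>2 + 1))"

definition drawing_to_S3 :: "('v, space3) drawing \<Rightarrow> ('v, space4) drawing" where
  "drawing_to_S3 D = \<lparr>vpoint = to_S3 \<circ> vpoint D, epath = (\<lambda>e. to_S3 \<circ> epath D e)\<rparr>"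

text \<open>\<open>h\<close> is the final map of an ambient isotopy of \<open>S\<^sup>3\<close>.\<close>

definition ambient_isotopy_end :: "(space4 \<Rightarrow> space4) \<Rightarrow> bool" where
  "ambient_isotopy_end h \<longleftrightarrow>
     homotopic_with (homeomorphic_map (top_of_set S3) (top_of_set S3))
       (top_of_set S3) (top_of_set S3) id h"

text \<open>The images of two embeddings, as geometric objects made of vertices and edges, are
  ambient isotopic.\<close>

definition ambient_isotopic ::
    "'v ugraph \<Rightarrow> ('v, space4) drawing \<Rightarrow> ('v, space4) drawing \<Rightarrow> bool" where
  "ambient_isotopic G D D' \<longleftrightarrow> (\<exists>h. ambient_isotopy_end h \<and>
     h ` vpoint D ` verts G = vpoint D' ` verts G \<and>
     (\<lambda>e. h ` eimage D e) ` edges G = eimage D' ` edges G)"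

definition polygonal_embedding :: "'v ugraph \<Rightarrow> ('v, space3) drawing \<Rightarrow> bool" where
  "polygonal_embedding G D \<longleftrightarrow> embeds_in G UNIV D \<and>
     (\<forall>e\<in>edges G. \<exists>S. finite S \<and> eimage D e = (\<Union>(a, b)\<in>S. closed_segment a b))"

definition tame_embeddings :: "'v ugraph \<Rightarrow> ('v, space4) drawing set" where
  "tame_embeddings G = {D. embeds_in G S3 D \<and>
     (\<exists>P. polygonal_embedding G P \<and> ambient_isotopic G (drawing_to_S3 P) D)}"

text \<open>The spatial graphs with underlying graph \<open>G\<close> are the classes of tame embeddings of
  \<open>G\<close> in \<open>S\<^sup>3\<close> whose images are ambient isotopic.\<close>

definition spatial_graphs :: "'v ugraph \<Rightarrow> ('v, space4) drawing set set" where
  "spatial_graphs G = tame_embeddings G //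
     {(D, D'). D \<in> tame_embeddings G \<and> D' \<in> tame_embeddings G \<and> ambient_isotopic G D D'}"

text \<open>\<open>standard_equator\<close> is the equator of the sphere \<open>S\<^sup>2 = S3 \<inter> {x. snd x = 0}\<close>. A tame sphere
  in \<open>S\<^sup>3\<close> is the image of this sphere under a self-homeomorphism of \<open>S\<^sup>3\<close>.\<close>

definition standard_equator :: "space4 set" where
  "standard_equator = {x \<in> S3. snd x = 0 \<and> snd (fst x) = 0}"

definition unknotted :: "space4 set \<Rightarrow> bool" where
  "unknotted K \<longleftrightarrow>
     (\<exists>h. homeomorphic_map (top_of_set S3) (top_of_set S3) h \<and> K = h ` standard_equator)"

text \<open>A diagram is encoded by a polygonal embedding in \<open>\<real>\<^sup>2 \<times> \<real>\<close> whose projection by \<^const>\<open>fst\<close> is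
  regular; the over/under information is the order of the heights. At a double point both
  strands are locally straight, with linearly independent projected directions.\<close>

definition straight_near :: "space3 set \<Rightarrow> space3 \<Rightarrow> space3 \<Rightarrow> bool" where
  "straight_near X p u \<longleftrightarrow>
     (\<exists>\<epsilon>>0. X \<inter> ball p \<epsilon> = {p + t *\<^sub>R u | t. True} \<inter> ball p \<epsilon>)"

definition is_diagram :: "'v ugraph \<Rightarrow> ('v, space3) drawing \<Rightarrow> bool" where
  "is_diagram G D \<longleftrightarrow> polygonal_embedding G D \<and>
     (let X = graph_image G D in
      \<forall>p\<in>X. \<forall>q\<in>X. p \<noteq> q \<and> fst p = fst q \<longrightarrow>
        p \<notin> vpoint D ` verts G \<and> q \<notin> vpoint D ` verts G \<and>
        (\<forall>r\<in>X. fst r = fst p \<longrightarrow> r = p \<or> r = q) \<and>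
        (\<exists>u v. straight_near X p u \<and> straight_near X q v \<and> \<not> collinear {0, fst u, fst v}))"

definition diagrams_of ::
    "'v ugraph \<Rightarrow> ('v, space4) drawing set \<Rightarrow> ('v, space3) drawing set" where
  "diagrams_of G \<G> = {D. is_diagram G D \<and> drawing_to_S3 D \<in> \<G>}"

definition crosses_over :: "space3 set \<Rightarrow> space3 set \<Rightarrow> bool" where
  "crosses_over A B \<longleftrightarrow> (\<exists>p\<in>A. \<exists>q\<in>B. fst p = fst q \<and> snd q < snd p)"

text \<open>A move of type 1 can remove a crossing iff the diagram has an empty monogon: a piece
  \<open>a\<close> of an edge running from a crossing back to that crossing and projecting to a simple
  closed curve whose inside does not meet the diagram. A move of type 2 can remove two
  crossings iff there is an empty bigon, one side \<open>a\<close> of which is the upper strand at both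
  crossings.\<close>

definition R1_reducible :: "'v ugraph \<Rightarrow> ('v, space3) drawing \<Rightarrow> bool" where
  "R1_reducible G D \<longleftrightarrow> (\<exists>e\<in>edges G. \<exists>a.
     arc a \<and> path_image a \<subseteq> eimage D e \<and>
     simple_path (fst \<circ> a) \<and> pathfinish (fst \<circ> a) = pathstart (fst \<circ> a) \<and>
     inside (path_image (fst \<circ> a)) \<inter> fst ` graph_image G D = {})"

definition R2_reducible :: "'v ugraph \<Rightarrow> ('v, space3) drawing \<Rightarrow> bool" where
  "R2_reducible G D \<longleftrightarrow> (\<exists>e\<in>edges G. \<exists>e'\<in>edges G. \<exists>a b.
     path_image a \<subseteq> eimage D e \<and> path_image b \<subseteq> eimage D e' \<and>
     arc (fst \<circ> a) \<and> arc (fst \<circ> b) \<and> path a \<and> path b \<and>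
     pathstart (fst \<circ> a) = pathstart (fst \<circ> b) \<and>
     pathfinish (fst \<circ> a) = pathfinish (fst \<circ> b) \<and>
     path_image (fst \<circ> a) \<inter> path_image (fst \<circ> b)
       = {pathstart (fst \<circ> a), pathfinish (fst \<circ> a)} \<and>
     snd (pathstart b) < snd (pathstart a) \<and> snd (pathfinish b) < snd (pathfinish a) \<and>
     inside (path_image (fst \<circ> a) \<union> path_image (fst \<circ> b)) \<inter> fst ` graph_image G D = {})"

definition reduced_diagram :: "'v ugraph \<Rightarrow> ('v, space3) drawing \<Rightarrow> bool" where
  "reduced_diagram G D \<longleftrightarrow> \<not> R1_reducible G D \<and> \<not> R2_reducible G D"

definition cycle_image :: "('v, 'p::topological_space) drawing \<Rightarrow> 'v list \<Rightarrow> 'p set" where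
  "cycle_image D c = (\<Union>e\<in>cycle_edges c. eimage D e)"

definition fragments ::
    "'v ugraph \<Rightarrow> ('v, 'p::topological_space) drawing \<Rightarrow> 'v list \<Rightarrow> 'p set set" where
  "fragments G D c = closure ` components (graph_image G D - cycle_image D c)"

definition semi_leveled_diagram ::
    "'v ugraph \<Rightarrow> ('v, space3) drawing \<Rightarrow> 'v list \<Rightarrow> bool" where
  "semi_leveled_diagram G D c \<longleftrightarrow>
     is_diagram G D \<and> is_cycle G c \<and> unknotted (to_S3 ` cycle_image D c) \<and>
     (\<forall>A\<in>fragments G D c.
        inj_on fst A \<and>
        \<not> crosses_over A (cycle_image D c) \<and> \<not> crosses_over (cycle_image D c) A \<and>
        (\<forall>B\<in>fragments G D c. B \<noteq> A \<longrightarrow> \<not> (crosses_over A B \<and> crosses_over B A)))"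

definition level_partition :: "space3 set set \<Rightarrow> nat \<Rightarrow> (nat \<Rightarrow> space3 set set) \<Rightarrow> bool" where
  "level_partition F n L \<longleftrightarrow>
     (\<Union>i\<in>{1..n}. L i) = F \<and> disjoint_family_on L {1..n} \<and> (\<forall>i\<in>{1..n}. L i \<noteq> {}) \<and>
     (1 \<le> n \<longrightarrow> L 1 = {A\<in>F. \<forall>B\<in>F. B \<noteq> A \<longrightarrow> \<not> crosses_over A B}) \<and>
     (\<forall>i\<in>{2..n}. L i = {A\<in>F. (\<exists>B\<in>L (i - 1). crosses_over A B) \<and>
        (\<forall>B\<in>F. B \<noteq> A \<and> crosses_over A B \<longrightarrow> (\<exists>k\<in>{1..<i}. B \<in> L k))})"

text \<open>That the complement of the projected spine has exactly one bounded component means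
  that the spine has no self-crossings; the bounded component is then \<^const>\<open>inside\<close>.
  A diagram consisting of the spine only is counted as having one level.\<close>

definition leveled_diagram ::
    "'v ugraph \<Rightarrow> ('v, space3) drawing \<Rightarrow> 'v list \<Rightarrow> nat \<Rightarrow> bool" where
  "leveled_diagram G D c n \<longleftrightarrow>
     semi_leveled_diagram G D c \<and> reduced_diagram G D \<and>
     inj_on fst (cycle_image D c) \<and>
     (\<forall>A\<in>fragments G D c. fst ` (A - cycle_image D c) \<subseteq> inside (fst ` cycle_image D c)) \<and>
     (if fragments G D c = {} then n = 1 else \<exists>L. level_partition (fragments G D c) n L)"

definition level_number :: "'v ugraph \<Rightarrow> ('v, space4) drawing set \<Rightarrow> enat" where
  "level_number G \<G> = Inf {enat n | n. \<exists>c. \<exists>D\<in>diagrams_of G \<G>. leveled_diagram G D c n}"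

definition graph_level_number :: "'v ugraph \<Rightarrow> enat" where
  "graph_level_number G = (INF \<G>\<in>spatial_graphs G. level_number G \<G>)"

definition ham_level_number :: "'v ugraph \<Rightarrow> ('v, space4) drawing set \<Rightarrow> enat" where
  "ham_level_number G \<G> = Inf {enat n | n. \<exists>c. is_hamiltonian_cycle G c \<and>
     (\<exists>D\<in>diagrams_of G \<G>. leveled_diagram G D c n)}"

definition graph_ham_level_number :: "'v ugraph \<Rightarrow> enat" where
  "graph_ham_level_number G = (INF \<G>\<in>spatial_graphs G. ham_level_number G \<G>)"

end

theory Submission
  imports Defs
begin

text \<open>
  Fix a diagram with spine \<open>c\<close> divided in \<open>n\<close> levels. Two fragments of the same level never cross
  over one another: those of the first level cross over nothing, and those of a later level cross
  over strictly lower levels only. No fragment crosses itself or the spine, and the spine does not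
  cross itself. Hence the projection to the plane is injective on the union of the spine with all
  fragments of one level, and it draws this part of the graph in the plane
  (\<open>leveled_diagram_pages\<close>). Since every edge off the spine lies in a fragment, and every fragment
  in some level, \<open>n\<close> planar subgraphs cover the graph. This bounds the thickness.

  Let now the spine be Hamiltonian. Every edge off the spine is a chord of the spine, and the
  projections of the chords lie inside the projected spine, which is a Jordan curve. Two chords of
  one level whose ends alternate along the spine cannot exist: the first one divides the inside
  into two parts, whose closures contain one of the two arcs of the spine each, and the
  second one, disjoint from the first, would have to lie in one part while ending on both arcs
  (\<open>crosscut_separates\<close>, \<open>interleaved_chords_cross\<close>). What remains is combinatorial. Put the
  vertices on a line in the order of the spine and give each level a half-plane. An edge
  becomes the parabola \<open>s = (t - x) (y - t)\<close> over the segment \<open>[x, y]\<close> between its ends. All these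
  parabolas have the same leading coefficient, so two of them differ by a linear function and do
  not meet above the line unless their segments overlap without being nested, that is, unless the
  ends alternate (\<open>parabolas_meet_at_ends\<close>). Edges of the spine alternate with no edge, so it
  does not matter which page receives them.
\<close>

section \<open>Drawings under maps and restrictions\<close>

definition map_drawing :: "('p \<Rightarrow> 'q) \<Rightarrow> ('v, 'p) drawing \<Rightarrow> ('v, 'q) drawing" where
  "map_drawing f D = \<lparr>vpoint = f \<circ> vpoint D, epath = (\<lambda>e. f \<circ> epath D e)\<rparr>"

lemma vpoint_map_drawing [simp]: "vpoint (map_drawing f D) = f \<circ> vpoint D"
  by (simp add: map_drawing_def)

lemma eimage_map_drawing [simp]: "eimage (map_drawing f D) e = f ` eimage D e"
  by (simp add: map_drawing_def eimage_def path_image_compose)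

lemma cycle_image_map_drawing: "cycle_image (map_drawing f D) c = f ` cycle_image D c"
  by (auto simp: cycle_image_def)

lemma eimage_subset_graph_image: "e \<in> edges G \<Longrightarrow> eimage D e \<subseteq> graph_image G D"
  by (auto simp: graph_image_def)

lemma embeds_in_edges_meet:
  assumes "embeds_in G X D" "e \<in> edges G" "e' \<in> edges G" "e \<noteq> e'"
  shows "eimage D e \<inter> eimage D e' = vpoint D ` (e \<inter> e')"
  using assms unfolding embeds_in_def by blast

lemma embeds_in_map_drawing:
  assumes emb: "embeds_in G X D" and simple: "simple_graph G"
    and cont: "continuous_on (graph_image G D) f" and inj: "inj_on f (graph_image G D)"
  shows "embeds_in G UNIV (map_drawing f D)"
proof -
  have V: "vpoint D ` verts G \<subseteq> graph_image G D" by (auto simp: graph_image_def)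
  have sub: "vpoint D ` e \<subseteq> graph_image G D" if "e \<in> edges G" for e
    using that simple V by (auto simp: simple_graph_def)
  have "arc (f \<circ> epath D e)" if e: "e \<in> edges G" for e
  proof -
    have a: "arc (epath D e)" using emb e by (auto simp: embeds_in_def)
    have s: "path_image (epath D e) \<subseteq> graph_image G D"
      using eimage_subset_graph_image[OF e, of D] by (simp add: eimage_def)
    show ?thesis
      unfolding arc_def
    proof
      show "path (f \<circ> epath D e)"
        using a s cont by (intro path_continuous_image arc_imp_path continuous_on_subset[OF cont])
      have "inj_on (epath D e) {0..1}" using a by (simp add: arc_def)
      moreover have "inj_on f (epath D e ` {0..1})"
        using inj s by (auto simp: path_image_def intro: inj_on_subset)
      ultimately show "inj_on (f \<circ> epath D e) {0..1}" by (rule comp_inj_on)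
    qed
  qed
  moreover have "{pathstart (f \<circ> epath D e), pathfinish (f \<circ> epath D e)} = (f \<circ> vpoint D) ` e"
    if e: "e \<in> edges G" for e
  proof -
    have "{pathstart (epath D e), pathfinish (epath D e)} = vpoint D ` e"
      using emb e by (auto simp: embeds_in_def)
    then have "f ` {pathstart (epath D e), pathfinish (epath D e)} = f ` vpoint D ` e" by simp
    then show ?thesis by (simp add: pathstart_compose pathfinish_compose image_comp)
  qed
  moreover have "f ` eimage D e \<inter> (f \<circ> vpoint D) ` verts G = (f \<circ> vpoint D) ` e"
    if e: "e \<in> edges G" for e
  proof -
    have "f ` eimage D e \<inter> f ` (vpoint D ` verts G) = f ` (eimage D e \<inter> vpoint D ` verts G)"
      using inj_on_image_Int[OF inj eimage_subset_graph_image[OF e] V] by simp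
    also have "eimage D e \<inter> vpoint D ` verts G = vpoint D ` e"
      using emb e by (auto simp: embeds_in_def)
    finally show ?thesis by (simp add: image_comp)
  qed
  moreover have "f ` eimage D e \<inter> f ` eimage D e' = (f \<circ> vpoint D) ` (e \<inter> e')"
    if e: "e \<in> edges G" "e' \<in> edges G" "e \<noteq> e'" for e e'
  proof -
    have "f ` eimage D e \<inter> f ` eimage D e' = f ` (eimage D e \<inter> eimage D e')"
      using inj_on_image_Int[OF inj eimage_subset_graph_image[OF e(1)] eimage_subset_graph_image[OF e(2)]]
      by simp
    also have "eimage D e \<inter> eimage D e' = vpoint D ` (e \<inter> e')"
      using emb e unfolding embeds_in_def by blast
    finally show ?thesis by (simp add: image_comp)
  qed
  moreover have "inj_on (f \<circ> vpoint D) (verts G)"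
    using emb inj V by (auto simp: embeds_in_def intro!: comp_inj_on intro: inj_on_subset)
  ultimately show ?thesis
    unfolding embeds_in_def by (auto simp: map_drawing_def eimage_def path_image_compose)
qed

lemma embeds_in_fewer_edges:
  assumes "embeds_in G X D" "verts S = verts G" "edges S \<subseteq> edges G"
  shows "embeds_in S X D"
proof -
  have "graph_image S D \<subseteq> graph_image G D"
    unfolding graph_image_def assms(2) using assms(3) by (intro Un_mono UN_mono) auto
  moreover have "e \<in> edges G" if "e \<in> edges S" for e using that assms(3) by blast
  ultimately show ?thesis
    using assms(1) unfolding embeds_in_def assms(2) by (auto intro: subset_trans)
qed

section \<open>Edges off the spine\<close>

lemma edge_ends_in_eimage:
  assumes "embeds_in G X D" "e \<in> edges G"
  shows "vpoint D ` e \<subseteq> eimage D e"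
  using assms unfolding embeds_in_def by blast

lemma oriented_edge_arc:
  assumes "embeds_in G X D" "{u, v} \<in> edges G" "u \<noteq> v"
  obtains g where "arc g" "path_image g = eimage D {u, v}"
    "pathstart g = vpoint D u" "pathfinish g = vpoint D v"
proof -
  let ?g = "epath D {u, v}"
  have a: "arc ?g" and s: "{pathstart ?g, pathfinish ?g} = {vpoint D u, vpoint D v}"
    using assms by (auto simp: embeds_in_def)
  show ?thesis
  proof (cases "pathstart ?g = vpoint D u")
    case True
    then have "pathfinish ?g = vpoint D v" using s by (metis doubleton_eq_iff)
    then show ?thesis using that[of ?g] a True by (simp add: eimage_def)
  next
    case False
    then have "pathstart ?g = vpoint D v" "pathfinish ?g = vpoint D u"
      using s by (metis doubleton_eq_iff)+
    then show ?thesis using that[of "reversepath ?g"] a by (simp add: eimage_def arc_reversepath)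
  qed
qed

text \<open>An arc is the continuous image of a closed interval, which is the closure of the open one.\<close>

lemma path_image_subset_closure_endless:
  fixes g :: "real \<Rightarrow> 'a::t2_space"
  assumes "arc g"
  shows "path_image g \<subseteq> closure (path_image g - {pathstart g, pathfinish g})"
proof -
  have "continuous_on (closure {0<..<1}) g"
    using assms by (simp add: arc_def path_def)
  then have "g ` closure {0<..<1} \<subseteq> closure (g ` {0<..<1})"
    by (intro image_closure_subset) (simp_all add: closure_subset)
  moreover have "path_image g - {pathstart g, pathfinish g} = g ` {0<..<1}"
    using simple_path_endless[OF arc_imp_simple_path[OF assms]] .
  ultimately show ?thesis by (simp add: path_image_def)
qed

lemma open_edge_connected_dense:
  fixes D :: "('v, 'p::t2_space) drawing"
  assumes "embeds_in G X D" "e \<in> edges G"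
  shows "connected (eimage D e - vpoint D ` e)" "eimage D e - vpoint D ` e \<noteq> {}"
    "eimage D e \<subseteq> closure (eimage D e - vpoint D ` e)"
proof -
  have a: "arc (epath D e)" and s: "{pathstart (epath D e), pathfinish (epath D e)} = vpoint D ` e"
    using assms by (auto simp: embeds_in_def)
  show "connected (eimage D e - vpoint D ` e)"
    unfolding s[symmetric] eimage_def
    by (rule connected_simple_path_endless[OF arc_imp_simple_path[OF a]])
  show "eimage D e - vpoint D ` e \<noteq> {}"
    unfolding s[symmetric] eimage_def
    by (rule nonempty_simple_path_endless[OF arc_imp_simple_path[OF a]])
  show "eimage D e \<subseteq> closure (eimage D e - vpoint D ` e)"
    unfolding s[symmetric] eimage_def by (rule path_image_subset_closure_endless[OF a])
qed

lemma open_edge_disjoint_spine: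
  assumes "embeds_in G X D" "is_cycle G c" "e \<in> edges G" "e \<notin> cycle_edges c"
  shows "(eimage D e - vpoint D ` e) \<inter> cycle_image D c = {}"
proof -
  have "eimage D e \<inter> eimage D e' \<subseteq> vpoint D ` e" if "e' \<in> cycle_edges c" for e'
  proof -
    have "e' \<in> edges G" "e \<noteq> e'" using assms that by (auto simp: is_cycle_def)
    then have "eimage D e \<inter> eimage D e' = vpoint D ` (e \<inter> e')"
      using assms unfolding embeds_in_def by blast
    then show ?thesis by auto
  qed
  then show ?thesis by (auto simp: cycle_image_def)
qed

text \<open>Without its ends the edge is connected and avoids the spine, so it lies in one component of the
  complement of the spine; taking closures returns the ends.\<close>

lemma edge_in_fragment:
  fixes D :: "('v, 'p::t2_space) drawing"
  assumes "embeds_in G X D" "is_cycle G c" "e \<in> edges G" "e \<notin> cycle_edges c"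
  shows "\<exists>A\<in>fragments G D c. eimage D e \<subseteq> A"
proof -
  let ?T = "eimage D e - vpoint D ` e" and ?S = "graph_image G D - cycle_image D c"
  have "?T \<subseteq> ?S"
    using open_edge_disjoint_spine[OF assms] eimage_subset_graph_image[OF assms(3)] by blast
  then obtain K where K: "K \<in> components ?S" "?T \<subseteq> K"
    using open_edge_connected_dense[OF assms(1,3)] exists_component_superset
    by (metis subset_empty)
  then have "eimage D e \<subseteq> closure K"
    using open_edge_connected_dense(3)[OF assms(1,3)] closure_mono by blast
  with K show ?thesis by (auto simp: fragments_def)
qed

section \<open>Each level projects injectively\<close>

text \<open>The spine edges belong to every \<^term>\<open>page_graph G c page i\<close>, whatever page they are
  assigned: the exclusion of alternating chords within one level needs the whole Jordan curve.\<close>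

definition page_graph :: "'v ugraph \<Rightarrow> 'v list \<Rightarrow> ('v set \<Rightarrow> nat) \<Rightarrow> nat \<Rightarrow> 'v ugraph" where
  "page_graph G c page i =
     \<lparr>verts = verts G, edges = {e \<in> edges G. e \<in> cycle_edges c \<or> page e = i}\<rparr>"

lemma page_graph_simps [simp]:
  "verts (page_graph G c page i) = verts G"
  "edges (page_graph G c page i) = {e \<in> edges G. e \<in> cycle_edges c \<or> page e = i}"
  by (simp_all add: page_graph_def)

lemma level_partition_no_crossing:
  assumes "level_partition F n L" "i \<in> {1..n}" "A \<in> L i" "B \<in> L i" "A \<noteq> B"
  shows "\<not> crosses_over A B"
proof
  assume cross: "crosses_over A B"
  have "(\<Union>i\<in>{1..n}. L i) = F" using assms(1) by (simp add: level_partition_def)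
  then have B: "B \<in> F" using assms(2,4) by blast
  show False
  proof (cases "i = 1")
    case True
    then have "L i = {A\<in>F. \<forall>B\<in>F. B \<noteq> A \<longrightarrow> \<not> crosses_over A B}"
      using assms(1)[unfolded level_partition_def] assms(2) by (elim conjE) simp
    then show False using assms(3,5) B cross by blast
  next
    case False
    then have i: "i \<in> {2..n}" using assms(2) by auto
    then have "L i = {A\<in>F. (\<exists>B\<in>L (i - 1). crosses_over A B) \<and>
        (\<forall>B\<in>F. B \<noteq> A \<and> crosses_over A B \<longrightarrow> (\<exists>k\<in>{1..<i}. B \<in> L k))}"
      using assms(1)[unfolded level_partition_def] by (elim conjE) (rule bspec)
    then obtain k where k: "k \<in> {1..<i}" "B \<in> L k" using assms(3,5) B cross by blast
    have "disjoint_family_on L {1..n}" using assms(1) by (simp add: level_partition_def)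
    then have "L k \<inter> L i = {}"
      using k(1) assms(2) by (intro disjoint_family_onD) auto
    then show False using k assms(4) by blast
  qed
qed

text \<open>If two points of one level project to the same point, then they differ in height, so one
  of the pieces that contain them crosses over the other. Vertices are excluded from crossings in
  any diagram, which is why all of them can be kept in every
  \<^const>\<open>page_graph\<close>.\<close>

lemma leveled_diagram_pages:
  assumes lev: "leveled_diagram G D c n"
  obtains page where "1 \<le> n" "\<And>e. e \<in> edges G \<Longrightarrow> page e < n"
    "\<And>i. i < n \<Longrightarrow> inj_on fst (graph_image (page_graph G c page i) D)"
proof -
  let ?F = "fragments G D c" and ?C = "cycle_image D c"
  have semi: "semi_leveled_diagram G D c" and injC: "inj_on fst ?C"
    using lev by (simp_all add: leveled_diagram_def)
  have diag: "is_diagram G D" and cyc: "is_cycle G c"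
    using semi by (simp_all add: semi_leveled_diagram_def)
  have emb: "embeds_in G UNIV D" using diag by (simp add: is_diagram_def polygonal_embedding_def)
  note frag = edge_in_fragment[OF emb cyc]
  \<comment> \<open>Levels are renumbered from \<open>0\<close>; a diagram without fragments gets one empty level.\<close>
  obtain \<L> :: "nat \<Rightarrow> space3 set set" where n: "1 \<le> n"
    and sub: "\<And>i. i < n \<Longrightarrow> \<L> i \<subseteq> ?F"
    and cov: "\<And>A. A \<in> ?F \<Longrightarrow> \<exists>i<n. A \<in> \<L> i"
    and nocross: "\<And>i A B. i < n \<Longrightarrow> A \<in> \<L> i \<Longrightarrow> B \<in> \<L> i \<Longrightarrow> A \<noteq> B \<Longrightarrow> \<not> crosses_over A B"
  proof (cases "?F = {}")
    case True
    then have "n = 1" using lev by (simp add: leveled_diagram_def)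
    then show ?thesis using that[of "\<lambda>_. {}"] True by simp
  next
    case False
    then obtain L where L: "level_partition ?F n L"
      using lev by (auto simp add: leveled_diagram_def simp del: ball_simps)
    have U: "(\<Union>i\<in>{1..n}. L i) = ?F" using L by (simp add: level_partition_def)
    show ?thesis
    proof (rule that[of "\<lambda>i. L (Suc i)"])
      show "1 \<le> n" using U False by (cases n) auto
      show "L (Suc i) \<subseteq> ?F" if "i < n" for i
      proof -
        have "Suc i \<in> {1..n}" using that by simp
        then show ?thesis using U by blast
      qed
      show "\<exists>i<n. A \<in> L (Suc i)" if "A \<in> ?F" for A
      proof -
        have "A \<in> (\<Union>i\<in>{1..n}. L i)" using that U by simp
        then obtain i where "i \<in> {1..n}" "A \<in> L i" by blast
        then show ?thesis by (intro exI[of _ "i - 1"]) auto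
      qed
      show "\<not> crosses_over A B" if "i < n" "A \<in> L (Suc i)" "B \<in> L (Suc i)" "A \<noteq> B" for i A B
        using level_partition_no_crossing[OF L _ that(2-4)] that(1) by simp
    qed
  qed
  have "\<exists>i<n. e \<notin> cycle_edges c \<longrightarrow> (\<exists>A\<in>\<L> i. eimage D e \<subseteq> A)" if "e \<in> edges G" for e
  proof (cases "e \<in> cycle_edges c")
    case True
    then show ?thesis using n by (intro exI[of _ 0]) auto
  next
    case False
    then show ?thesis using frag[OF that] cov by blast
  qed
  then obtain page where page: "\<And>e. e \<in> edges G \<Longrightarrow> page e < n"
    and pageA: "\<And>e. e \<in> edges G \<Longrightarrow> e \<notin> cycle_edges c \<Longrightarrow> \<exists>A\<in>\<L> (page e). eimage D e \<subseteq> A"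
    by metis
  have "inj_on fst (graph_image (page_graph G c page i) D)" if i: "i < n" for i
  proof (rule inj_onI, rule ccontr)
    let ?S = "page_graph G c page i"
    fix p q assume p: "p \<in> graph_image ?S D" and q: "q \<in> graph_image ?S D"
      and eq: "fst p = fst q" and ne: "p \<noteq> q"
    have G: "p \<in> graph_image G D" "q \<in> graph_image G D" using p q by (auto simp: graph_image_def)
    have "p \<notin> vpoint D ` verts G" "q \<notin> vpoint D ` verts G"
      using bspec[OF bspec[OF conjunct2[OF diag[unfolded is_diagram_def Let_def]]], of p q, OF G] eq ne
      by simp_all
    moreover have "x \<in> ?C \<or> (\<exists>A\<in>\<L> i. x \<in> A)"
      if "x \<in> graph_image ?S D" "x \<notin> vpoint D ` verts G" for x
    proof -
      have "x \<in> (\<Union>e\<in>edges ?S. eimage D e)"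
        using that unfolding graph_image_def page_graph_simps(1) by blast
      then obtain e where "e \<in> edges ?S" "x \<in> eimage D e" by blast
      then show ?thesis using pageA[of e] by (cases "e \<in> cycle_edges c") (auto simp: cycle_image_def)
    qed
    ultimately have pq: "p \<in> ?C \<or> (\<exists>A\<in>\<L> i. p \<in> A)" "q \<in> ?C \<or> (\<exists>A\<in>\<L> i. q \<in> A)"
      using p q by blast+
    have "snd p \<noteq> snd q" using eq ne by (auto simp: prod_eq_iff)
    then have cross: "crosses_over X Y \<or> crosses_over Y X" if "p \<in> X" "q \<in> Y" for X Y
      using eq that unfolding crosses_over_def by (metis linorder_neqE)
    have flat: "inj_on fst A" "\<not> crosses_over A ?C" "\<not> crosses_over ?C A" if "A \<in> \<L> i" for A
    proof -
      have "A \<in> ?F" using sub[OF i] that by blast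
      then show "inj_on fst A" "\<not> crosses_over A ?C" "\<not> crosses_over ?C A"
        using semi by (simp_all add: semi_leveled_diagram_def)
    qed
    have noC: "x \<notin> ?C \<or> y \<notin> A" if "A \<in> \<L> i" "{x, y} = {p, q}" for x y A
      using cross[of ?C A] cross[of A ?C] flat(2,3)[OF that(1)] that(2) by (auto simp: doubleton_eq_iff)
    consider "p \<in> ?C" "q \<in> ?C" | A where "A \<in> \<L> i" "p \<in> ?C" "q \<in> A"
      | A where "A \<in> \<L> i" "p \<in> A" "q \<in> ?C"
      | A B where "A \<in> \<L> i" "B \<in> \<L> i" "p \<in> A" "q \<in> B" using pq by blast
    then show False
    proof cases
      case 1
      then show ?thesis using inj_onD[OF injC eq] ne by blast
    next
      case (2 A)
      then show ?thesis using noC[of A p q] by blast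
    next
      case (3 A)
      then show ?thesis using noC[of A q p] by blast
    next
      case (4 A B)
      show ?thesis
      proof (cases "A = B")
        case True
        then show ?thesis using 4 inj_onD[OF flat(1) eq] ne by blast
      next
        case False
        then show ?thesis using 4 cross nocross[OF i] by blast
      qed
    qed
  qed
  with n page show ?thesis using that by blast
qed

lemma page_graph_planar:
  fixes D :: "('v, space3) drawing"
  assumes simple: "simple_graph G" and emb: "embeds_in G UNIV D"
    and inj: "inj_on fst (graph_image (page_graph G c page i) D)"
  shows "embeds_in (page_graph G c page i) UNIV (map_drawing fst D)"
proof (rule embeds_in_map_drawing[OF _ _ _ inj])
  show "embeds_in (page_graph G c page i) UNIV D"
    by (rule embeds_in_fewer_edges[OF emb]) auto
  show "simple_graph (page_graph G c page i)" using simple by (auto simp: simple_graph_def)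
qed (intro continuous_intros)

lemma thickness_le_levels:
  assumes simple: "simple_graph G" and lev: "leveled_diagram G D c n"
  shows "thickness G \<le> enat n"
proof -
  obtain page where n: "1 \<le> n" and page: "\<And>e. e \<in> edges G \<Longrightarrow> page e < n"
    and inj: "\<And>i. i < n \<Longrightarrow> inj_on fst (graph_image (page_graph G c page i) D)"
    using leveled_diagram_pages[OF lev] by blast
  have emb: "embeds_in G UNIV D"
    using lev by (simp add: leveled_diagram_def semi_leveled_diagram_def is_diagram_def
        polygonal_embedding_def)
  let ?S = "page_graph G c page"
  have "is_subgraph (?S i) G \<and> planar_graph (?S i)" if "i < n" for i
    using simple page_graph_planar[OF simple emb inj[OF that]]
    by (auto simp: is_subgraph_def planar_graph_def simple_graph_def)
  moreover have "(\<Union>i<n. verts (?S i)) = verts G" using n by (auto simp: lessThan_empty_iff)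
  moreover have "(\<Union>i<n. edges (?S i)) = edges G" using page n by auto
  ultimately show ?thesis
    unfolding thickness_def by (intro Inf_lower) blast
qed

section \<open>Chords of a Jordan curve\<close>

text \<open>The separation theorem for theta curves lives in the complex plane, whereas diagrams are drawn
  in \<^typ>\<open>real^2\<close>; this lemma carries insides from one to the other.\<close>

lemma inside_linear_image:
  fixes f :: "'a::euclidean_space \<Rightarrow> 'b::euclidean_space"
  assumes "linear f" "linear g" "\<And>x. g (f x) = x" "\<And>y. f (g y) = y"
  shows "f ` inside S \<subseteq> inside (f ` S)"
proof
  fix y assume "y \<in> f ` inside S"
  then obtain x where x: "x \<in> inside S" "y = f x" by blast
  let ?K = "connected_component_set (- f ` S) y"
  have notin: "y \<notin> f ` S" using x assms by (metis IntI empty_iff imageE inside_no_overlap)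
  have "connected (g ` ?K)"
    using assms(2) by (intro connected_continuous_image linear_continuous_on)
      (auto simp: linear_conv_bounded_linear)
  moreover have "x \<in> g ` ?K"
    using notin x assms(3) by (intro image_eqI[of _ _ y]) auto
  moreover have "g ` ?K \<subseteq> - S"
  proof
    fix x assume "x \<in> g ` ?K"
    then have "f x \<notin> f ` S" using assms(4) connected_component_subset[of "- f ` S" y] by auto
    then show "x \<in> - S" by blast
  qed
  ultimately have "g ` ?K \<subseteq> connected_component_set (- S) x"
    by (intro connected_component_maximal)
  then have "bounded (g ` ?K)" using x by (auto simp: inside_def intro: bounded_subset)
  then have "bounded (f ` g ` ?K)"
    using assms(1) by (rule bounded_linear_image[OF _ linear_conv_bounded_linear[THEN iffD1]])
  moreover have "f ` g ` ?K = ?K" using assms(4) by (simp add: image_comp o_def)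
  ultimately show "y \<in> inside (f ` S)" using notin by (simp add: inside_def)
qed

text \<open>The crosscut \<open>c\<close> divides the inside of the Jordan curve \<open>c1 \<union> c2\<close> into the insides of
  \<open>c1 \<union> c\<close> and \<open>c2 \<union> c\<close>. The connected set \<open>T\<close> lies in one of them, say the first, so
  its closure reaches \<open>c2\<close> at most at the common ends of the three arcs.\<close>

lemma crosscut_separates:
  fixes c :: "real \<Rightarrow> complex"
  assumes "simple_path c1" "pathstart c1 = a" "pathfinish c1 = b"
    and "simple_path c2" "pathstart c2 = a" "pathfinish c2 = b"
    and "simple_path c" "pathstart c = a" "pathfinish c = b"
    and "a \<noteq> b"
    and c12: "path_image c1 \<inter> path_image c2 = {a, b}"
    and c1c: "path_image c1 \<inter> path_image c = {a, b}"
    and c2c: "path_image c2 \<inter> path_image c = {a, b}"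
    and "path_image c \<inter> inside (path_image c1 \<union> path_image c2) \<noteq> {}"
    and T: "connected T" "T \<subseteq> inside (path_image c1 \<union> path_image c2)" "T \<inter> path_image c = {}"
    and p: "p \<in> closure T" "p \<in> path_image c1"
    and q: "q \<in> closure T" "q \<in> path_image c2"
  shows "p \<in> {a, b} \<or> q \<in> {a, b}"
proof (rule ccontr)
  assume "\<not> ?thesis"
  with p q have p': "p \<notin> path_image c2 \<union> path_image c" and q': "q \<notin> path_image c1 \<union> path_image c"
    using c12 c1c c2c by blast+
  let ?I1 = "inside (path_image c1 \<union> path_image c)" and ?I2 = "inside (path_image c2 \<union> path_image c)"
  let ?I = "inside (path_image c1 \<union> path_image c2)"
  obtain disj: "?I1 \<inter> ?I2 = {}" and un: "?I1 \<union> ?I2 \<union> (path_image c - {a, b}) = ?I"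
    using split_inside_simple_closed_curve[OF assms(1-14)] by metis
  have cl: "closed (path_image c1 \<union> path_image c)" "closed (path_image c2 \<union> path_image c)"
    using assms by (auto intro: closed_simple_path_image)
  have "T \<subseteq> ?I1 \<union> ?I2" using un T by blast
  then have "T \<subseteq> ?I1 \<or> T \<subseteq> ?I2"
    using connectedD[OF T(1) open_inside[OF cl(1)] open_inside[OF cl(2)]] disj by blast
  then show False
  proof
    assume "T \<subseteq> ?I1"
    then have "q \<in> ?I1" using closure_mono closure_inside_subset[OF cl(1)] q q' by blast
    then have "q \<in> ?I" using un by blast
    then show False using q inside_no_overlap by blast
  next
    assume "T \<subseteq> ?I2"
    then have "p \<in> ?I2" using closure_mono closure_inside_subset[OF cl(2)] p p' by blast
    then have "p \<in> ?I" using un by blast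
    then show False using p inside_no_overlap by blast
  qed
qed

section \<open>Arcs of a drawn cycle\<close>

lemma mod_neq_of_close:
  fixes a b n :: nat
  assumes "a < b" "b < a + n"
  shows "a mod n \<noteq> b mod n"
proof
  assume "a mod n = b mod n"
  then have "n dvd b - a" using assms by (metis mod_eq_dvd_iff_nat less_imp_le)
  then show False using assms by (auto dest: dvd_imp_le)
qed

text \<open>Letting the index run through all natural numbers, read modulo the length, makes each of the
  two arcs into which two vertices divide the cycle an interval of indices: \<open>{i..<j}\<close> and
  \<open>{j..<i + length c}\<close>.\<close>

definition cyclic_edge :: "'v list \<Rightarrow> nat \<Rightarrow> 'v set" where
  "cyclic_edge c k = {c ! (k mod length c), c ! (Suc k mod length c)}"

lemma cycle_edges_cyclic_edge:
  assumes "c \<noteq> []"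
  shows "cycle_edges c = cyclic_edge c ` {i..<i + length c}"
proof -
  let ?n = "length c"
  have n: "0 < ?n" using assms by simp
  have "cyclic_edge c k \<in> cycle_edges c" for k
    unfolding cycle_edges_def cyclic_edge_def using n
    by (auto intro!: exI[of _ "k mod ?n"] simp: mod_Suc_eq)
  moreover have "e \<in> cyclic_edge c ` {i..<i + ?n}" if e: "e \<in> cycle_edges c" for e
  proof -
    obtain m where m: "m < ?n" "e = {c ! m, c ! (Suc m mod ?n)}"
      using e by (auto simp: cycle_edges_def)
    \<comment> \<open>the representative of \<open>m\<close> modulo the length that lies in the window starting at \<open>i\<close>\<close>
    define k where "k = i + (m + ?n * i - i) mod ?n"
    have ge: "i \<le> m + ?n * i" using n by (cases ?n) auto
    have "k mod ?n = (i + (m + ?n * i - i)) mod ?n" by (simp add: k_def mod_add_right_eq)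
    also have "\<dots> = m mod ?n" using ge by simp
    finally have km: "k mod ?n = m" using m by simp
    then have "e = cyclic_edge c k"
      using m by (metis cyclic_edge_def mod_Suc_eq)
    moreover have "k \<in> {i..<i + ?n}" using n by (simp add: k_def)
    ultimately show ?thesis by blast
  qed
  ultimately show ?thesis by blast
qed

context
  fixes G :: "'v ugraph" and X :: "'p::t2_space set" and D :: "('v, 'p) drawing" and c :: "'v list"
  assumes emb: "embeds_in G X D" and cyc: "is_cycle G c"
begin

lemma cyclic_vertex_neq:
  assumes "a < b" "b < a + length c"
  shows "c ! (a mod length c) \<noteq> c ! (b mod length c)"
proof -
  have "0 < length c" using cyc by (auto simp: is_cycle_def)
  then show ?thesis
    using mod_neq_of_close[OF assms] cyc by (simp add: is_cycle_def nth_eq_iff_index_eq)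
qed

lemma cyclic_edge_in_edges: "cyclic_edge c k \<in> edges G"
proof -
  have "c \<noteq> []" "cycle_edges c \<subseteq> edges G" using cyc by (auto simp: is_cycle_def)
  then show ?thesis using cycle_edges_cyclic_edge[of c k] by auto
qed

lemma cyclic_edges_meet:
  assumes "k < l" "l < k + length c"
  shows "eimage D (cyclic_edge c k) \<inter> eimage D (cyclic_edge c l)
    \<subseteq> (if l = Suc k then {vpoint D (c ! (l mod length c))} else {}) \<union>
      (if Suc l = k + length c then {vpoint D (c ! (k mod length c))} else {})"
proof -
  let ?n = "length c" and ?v = "\<lambda>k. c ! (k mod length c)"
  have n: "3 \<le> ?n" using cyc by (simp add: is_cycle_def)
  have 1: "?v k \<noteq> ?v l" "?v (Suc k) \<noteq> ?v (Suc l)"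
    using assms by (intro cyclic_vertex_neq; simp)+
  have 2: "?v (Suc k) \<noteq> ?v l" if "l \<noteq> Suc k"
    using assms that by (intro cyclic_vertex_neq; simp)
  have 3: "?v k \<noteq> ?v (Suc l)" if "Suc l \<noteq> k + ?n"
    using assms that by (intro cyclic_vertex_neq; simp)
  have "cyclic_edge c k \<noteq> cyclic_edge c l"
  proof
    assume "cyclic_edge c k = cyclic_edge c l"
    then have "?v k = ?v (Suc l)" "?v (Suc k) = ?v l"
      using 1 by (auto simp: cyclic_edge_def doubleton_eq_iff)
    then have "l = Suc k" "Suc l = k + ?n" using 2 3 by blast+
    then show False using n by simp
  qed
  then have eq: "eimage D (cyclic_edge c k) \<inter> eimage D (cyclic_edge c l)
      = vpoint D ` (cyclic_edge c k \<inter> cyclic_edge c l)"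
    using emb cyclic_edge_in_edges unfolding embeds_in_def by blast
  have sub: "cyclic_edge c k \<inter> cyclic_edge c l
      \<subseteq> (if l = Suc k then {?v l} else {}) \<union> (if Suc l = k + ?n then {?v k} else {})"
    using 1 2 3 by (auto simp: cyclic_edge_def)
  show ?thesis using image_mono[OF sub, of "vpoint D"] unfolding eq by (auto split: if_splits)
qed

lemma cycle_segment_arc:
  assumes "i < j" "j < i + length c"
  shows "\<exists>g. arc g \<and> path_image g = (\<Union>k\<in>{i..<j}. eimage D (cyclic_edge c k)) \<and>
    pathstart g = vpoint D (c ! (i mod length c)) \<and> pathfinish g = vpoint D (c ! (j mod length c))"
  using assms
proof (induction j)
  case (Suc j)
  let ?v = "\<lambda>k. c ! (k mod length c)"
  have "?v j \<noteq> ?v (Suc j)" using Suc.prems by (intro cyclic_vertex_neq) auto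
  then obtain h where h: "arc h" "path_image h = eimage D (cyclic_edge c j)"
    "pathstart h = vpoint D (?v j)" "pathfinish h = vpoint D (?v (Suc j))"
    using oriented_edge_arc[OF emb, of "?v j" "?v (Suc j)"] cyclic_edge_in_edges[of j]
    unfolding cyclic_edge_def by blast
  show ?case
  proof (cases "j = i")
    case True
    then show ?thesis using h by (intro exI[of _ h]) auto
  next
    case False
    then obtain g where g: "arc g" "path_image g = (\<Union>k\<in>{i..<j}. eimage D (cyclic_edge c k))"
      "pathstart g = vpoint D (?v i)" "pathfinish g = vpoint D (?v j)"
      using Suc by auto
    have "eimage D (cyclic_edge c k) \<inter> eimage D (cyclic_edge c j) \<subseteq> {vpoint D (?v j)}"
      if "k \<in> {i..<j}" for k
      using cyclic_edges_meet[of k j] that Suc.prems by (auto split: if_splits)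
    then have "path_image g \<inter> path_image h \<subseteq> {pathstart h}"
      unfolding g(2) h(2,3) by blast
    then have "arc (g +++ h)" using g h by (intro arc_join) auto
    moreover have "path_image (g +++ h) = (\<Union>k\<in>{i..<Suc j}. eimage D (cyclic_edge c k))"
      using g h Suc.prems by (subst path_image_join) (auto simp: atLeastLessThanSuc)
    ultimately show ?thesis using g h by (intro exI[of _ "g +++ h"]) auto
  qed
qed simp

end

text \<open>The first chord is a crosscut of the Jordan curve given by the cycle; the second chord
  without its ends is a connected subset of the inside whose closure reaches both arcs
  of the cycle away from the first chord.\<close>

lemma interleaved_chords_cross:
  fixes D :: "('v, complex) drawing"
  assumes emb: "embeds_in G X D" and cyc: "is_cycle G c"
    and e: "{c ! i, c ! j} \<in> edges G - cycle_edges c"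
    and e': "{c ! k, c ! l} \<in> edges G - cycle_edges c"
    and ord: "i < k" "k < j" "j < l" "l < length c"
    and ins: "eimage D {c ! i, c ! j} - vpoint D ` {c ! i, c ! j} \<subseteq> inside (cycle_image D c)"
      "eimage D {c ! k, c ! l} - vpoint D ` {c ! k, c ! l} \<subseteq> inside (cycle_image D c)"
  shows False
proof -
  let ?n = "length c" and ?e = "{c ! i, c ! j}" and ?e' = "{c ! k, c ! l}"
  let ?a = "vpoint D (c ! i)" and ?b = "vpoint D (c ! j)"
  let ?E = "\<lambda>k. eimage D (cyclic_edge c k)"
  have dist: "distinct c" and V: "set c \<subseteq> verts G" using cyc by (auto simp: is_cycle_def)
  have vinj: "vpoint D (c ! x) = vpoint D (c ! y) \<longleftrightarrow> x = y" if "x < ?n" "y < ?n" for x y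
  proof -
    have "c ! x \<in> verts G" "c ! y \<in> verts G" using that V nth_mem by blast+
    then show ?thesis
      using emb that dist by (auto simp: embeds_in_def nth_eq_iff_index_eq dest: inj_onD)
  qed
  have modn: "x mod ?n = x" if "x < ?n" for x using that by simp
  obtain c1 where c1: "arc c1" "path_image c1 = (\<Union>k\<in>{i..<j}. ?E k)"
      "pathstart c1 = ?a" "pathfinish c1 = ?b"
    using cycle_segment_arc[OF emb cyc, of i j] ord modn[of i] modn[of j] by auto
  obtain g2 where g2: "arc g2" "path_image g2 = (\<Union>k\<in>{j..<i + ?n}. ?E k)"
      "pathstart g2 = ?b" "pathfinish g2 = ?a"
    using cycle_segment_arc[OF emb cyc, of j "i + ?n"] ord modn[of i] modn[of j] by auto
  define c2 where "c2 = reversepath g2"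
  have c2: "arc c2" "path_image c2 = (\<Union>k\<in>{j..<i + ?n}. ?E k)"
      "pathstart c2 = ?a" "pathfinish c2 = ?b"
    using g2 by (auto simp: c2_def arc_reversepath)
  have "c ! i \<noteq> c ! j" using ord dist by (simp add: nth_eq_iff_index_eq)
  then obtain h where h: "arc h" "path_image h = eimage D ?e" "pathstart h = ?a" "pathfinish h = ?b"
    using oriented_edge_arc[OF emb] e by blast
  have ends: "?a \<in> path_image g" "?b \<in> path_image g" if "pathstart g = ?a" "pathfinish g = ?b" for g
    using that by (metis pathstart_in_path_image pathfinish_in_path_image)+
  have "?E x \<inter> ?E y \<subseteq> {?a, ?b}" if "x \<in> {i..<j}" "y \<in> {j..<i + ?n}" for x y
  proof -
    have "x < y" "y < x + ?n" using that by auto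
    note meet = cyclic_edges_meet[OF emb cyc this]
    have "y = j" if "y = Suc x" using that \<open>x \<in> _\<close> \<open>y \<in> _\<close> by auto
    then have "(if y = Suc x then {vpoint D (c ! (y mod ?n))} else {}) \<subseteq> {?b}"
      using ord by auto
    moreover have "x = i" if "Suc y = x + ?n" using that \<open>x \<in> _\<close> \<open>y \<in> _\<close> by auto
    then have "(if Suc y = x + ?n then {vpoint D (c ! (x mod ?n))} else {}) \<subseteq> {?a}"
      using ord by auto
    ultimately show ?thesis using meet by blast
  qed
  then have "path_image c1 \<inter> path_image c2 \<subseteq> {?a, ?b}" using c1 c2 by blast
  then have c12: "path_image c1 \<inter> path_image c2 = {?a, ?b}" using ends c1 c2 by blast
  have "?E x \<inter> eimage D ?e \<subseteq> {?a, ?b}" for x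
  proof -
    have on: "cyclic_edge c x \<in> cycle_edges c"
      using cycle_edges_cyclic_edge[of c x] ord by fastforce
    have "cyclic_edge c x \<noteq> ?e"
    proof
      assume eq: "cyclic_edge c x = ?e"
      show False by (rule DiffD2[OF e on[unfolded eq]])
    qed
    then have "?E x \<inter> eimage D ?e = vpoint D ` (cyclic_edge c x \<inter> ?e)"
      by (rule embeds_in_edges_meet[OF emb cyclic_edge_in_edges[OF emb cyc] DiffD1[OF e]])
    also have "\<dots> \<subseteq> vpoint D ` ?e" by (rule image_mono) (rule Int_lower2)
    finally show ?thesis by simp
  qed
  then have "path_image c1 \<inter> path_image h \<subseteq> {?a, ?b}" "path_image c2 \<inter> path_image h \<subseteq> {?a, ?b}"
    using c1 c2 h by blast+
  then have ch: "path_image c1 \<inter> path_image h = {?a, ?b}" "path_image c2 \<inter> path_image h = {?a, ?b}"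
    using ends c1 c2 h by blast+
  have "c \<noteq> []" using ord by auto
  then have "cycle_edges c = cyclic_edge c ` ({i..<j} \<union> {j..<i + ?n})"
    using cycle_edges_cyclic_edge[of c i] ord by (simp add: ivl_disj_un)
  then have cycle: "cycle_image D c = path_image c1 \<union> path_image c2"
    unfolding cycle_image_def c1 c2 by auto
  let ?T = "eimage D ?e' - vpoint D ` ?e'"
  have ene: "?e \<noteq> ?e'" using ord dist by (auto simp: doubleton_eq_iff nth_eq_iff_index_eq)
  have "eimage D ?e \<inter> eimage D ?e' \<subseteq> vpoint D ` ?e'"
    unfolding embeds_in_edges_meet[OF emb DiffD1[OF e] DiffD1[OF e'] ene]
    by (rule image_mono) (rule Int_lower2)
  then have disj: "?T \<inter> path_image h = {}" unfolding h(2) by blast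
  have crosscut: "path_image h \<inter> inside (path_image c1 \<union> path_image c2) \<noteq> {}"
    using ins(1) open_edge_connected_dense(2)[OF emb DiffD1[OF e]] unfolding cycle h(2) by blast
  have ab: "?a \<noteq> ?b" using vinj ord by simp
  have T: "connected ?T" "vpoint D ` ?e' \<subseteq> closure ?T"
    using open_edge_connected_dense[OF emb DiffD1[OF e']] edge_ends_in_eimage[OF emb DiffD1[OF e']]
    by (blast intro: subset_trans)+
  have on: "vpoint D (c ! x) \<in> ?E x" if "x < ?n" for x
    using edge_ends_in_eimage[OF emb cyclic_edge_in_edges[OF emb cyc, of x]] that
    by (auto simp: cyclic_edge_def)
  have "vpoint D (c ! k) \<in> path_image c1"
    unfolding c1 using on[of k] ord by (intro UN_I[of k]) auto
  moreover have "vpoint D (c ! l) \<in> path_image c2"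
    unfolding c2 using on[of l] ord by (intro UN_I[of l]) auto
  moreover have "vpoint D (c ! k) \<in> closure ?T" "vpoint D (c ! l) \<in> closure ?T"
    using T(2) by auto
  ultimately have "vpoint D (c ! k) \<in> {?a, ?b} \<or> vpoint D (c ! l) \<in> {?a, ?b}"
    using crosscut_separates[OF arc_imp_simple_path[OF c1(1)] c1(3,4)
        arc_imp_simple_path[OF c2(1)] c2(3,4) arc_imp_simple_path[OF h(1)] h(3,4) ab c12 ch
        crosscut T(1) ins(2)[unfolded cycle] disj]
    by blast
  then show False using vinj ord by auto
qed

section \<open>Non-crossing pages form a book\<close>

text \<open>The relation is not symmetric: \<open>e\<close> is the edge that starts first. Edges whose ends alternate
  are interleaved in exactly one of the two orders.\<close>

definition interleaved :: "('v \<Rightarrow> nat) \<Rightarrow> 'v set \<Rightarrow> 'v set \<Rightarrow> bool" where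
  "interleaved pos e e' \<longleftrightarrow> (\<exists>u v u' v'. e = {u, v} \<and> e' = {u', v'} \<and>
     pos u < pos u' \<and> pos u' < pos v \<and> pos v < pos v')"

text \<open>The pages are half-planes through the first coordinate axis with the
  pairwise non-parallel directions \<open>(0, 1, i)\<close>. The summand \<open>0\<close> is the base point in
  the parametrisation of a line and of a half-plane.\<close>

definition page_point :: "nat \<Rightarrow> real \<Rightarrow> real \<Rightarrow> real^3" where
  "page_point i x s = 0 + x *\<^sub>R axis 1 1 + s *\<^sub>R (axis 2 1 + real i *\<^sub>R axis 3 1)"

lemma page_point_nth [simp]:
  "page_point i x s $ 1 = x" "page_point i x s $ 2 = s" "page_point i x s $ 3 = s * real i"
  by (simp_all add: page_point_def axis_def)

lemma page_point_eq_iff: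
  "page_point i x s = page_point j y t \<longleftrightarrow> x = y \<and> s = t \<and> (s = 0 \<or> i = j)"
  by (auto simp: vec_eq_iff forall_3)

definition page :: "nat \<Rightarrow> (real^3) set" where
  "page i = {page_point i x s | x s. 0 \<le> s}"

definition spine :: "(real^3) set" where
  "spine = {page_point 0 x 0 | x. True}"

lemma spine_eq: "spine = {0 + x *\<^sub>R axis 1 1 | x. True}"
  by (simp add: spine_def page_point_def)

lemma page_half_plane: "half_plane_with_boundary (page i) spine"
proof -
  let ?d = "axis 1 1 :: real^3" and ?u = "axis 2 1 + real i *\<^sub>R axis 3 1 :: real^3"
  have "\<not> collinear {0, ?d, ?u}"
    by (auto simp: collinear_lemma vec_eq_iff forall_3 axis_def)
  then show ?thesis
    unfolding half_plane_with_boundary_def spine_eq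
    by (intro exI[of _ "0::real^3"] exI[of _ ?d] exI[of _ ?u]) (simp add: page_def page_point_def)
qed

lemma inj_page: "inj page"
proof (rule injI)
  fix i j assume "page i = page j"
  moreover have "page_point i 0 1 \<in> page i" by (force simp: page_def)
  ultimately obtain x s where "page_point i 0 1 = page_point j x s" by (auto simp: page_def)
  then show "i = j" by (simp add: page_point_eq_iff)
qed

lemma is_book_pages:
  assumes "1 \<le> n"
  shows "is_book n spine (page ` {..<n})"
proof -
  have "is_line spine"
    unfolding is_line_def spine_eq
    by (intro exI[of _ "0::real^3"] exI[of _ "axis 1 1"]) (simp add: axis_eq_0_iff)
  then show ?thesis
    using assms page_half_plane
    by (simp add: is_book_def card_image inj_on_subset[OF inj_page])
qed

lemma page_point_rel_interior:
  assumes "0 < s"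
  shows "page_point i x s \<in> rel_interior (page i)"
proof -
  let ?plane = "{v :: real^3. v $ 3 = v $ 2 * real i}"
  have "subspace ?plane" by (auto simp: subspace_def algebra_simps)
  then have "affine hull page i \<subseteq> ?plane"
    by (intro hull_minimal subspace_imp_affine) (auto simp: page_def)
  moreover have "v \<in> page i" if "v \<in> ?plane" "0 < v $ 2" for v
  proof -
    have "v = page_point i (v $ 1) (v $ 2)" using that by (simp add: vec_eq_iff forall_3)
    then show ?thesis using that(2) unfolding page_def by fastforce
  qed
  moreover have "open {v :: real^3. 0 < v $ 2}"
    by (intro open_Collect_less continuous_intros)
  ultimately show ?thesis
    unfolding mem_rel_interior using assms
    by (intro exI[of _ "{v :: real^3. 0 < v $ 2}"]) (auto simp: page_def intro: less_imp_le)
qed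

text \<open>With \<open>z = x + t (y - x)\<close> the height is \<open>(z - x) (y - z)\<close>.\<close>

definition parabola :: "nat \<Rightarrow> real \<Rightarrow> real \<Rightarrow> real \<Rightarrow> real^3" where
  "parabola i x y t = page_point i (x + t * (y - x)) ((t * (y - x)) * ((1 - t) * (y - x)))"

lemma parabola_ends:
  "pathstart (parabola i x y) = page_point 0 x 0" "pathfinish (parabola i x y) = page_point 0 y 0"
  by (simp_all add: parabola_def pathstart_def pathfinish_def page_point_eq_iff)

lemma arc_parabola:
  assumes "x < y"
  shows "arc (parabola i x y)"
  unfolding arc_def
proof
  show "path (parabola i x y)"
    unfolding path_def parabola_def page_point_def by (intro continuous_intros)
  show "inj_on (parabola i x y) {0..1}"
    using assms by (auto simp: inj_on_def parabola_def page_point_eq_iff)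
qed

lemma path_image_parabola:
  assumes "x < y"
  shows "path_image (parabola i x y) = {page_point i z ((z - x) * (y - z)) | z. x \<le> z \<and> z \<le> y}"
proof -
  have "parabola i x y t = page_point i z ((z - x) * (y - z))" if "z = x + t * (y - x)" for z t
    unfolding that by (simp add: parabola_def page_point_eq_iff algebra_simps)
  then have "path_image (parabola i x y)
      = (\<lambda>z. page_point i z ((z - x) * (y - z))) ` (\<lambda>t. x + t * (y - x)) ` {0..1}"
    unfolding path_image_def image_image by (intro image_cong) auto
  also have "(\<lambda>t. x + t * (y - x)) ` {0..1} = {x..y}"
    using closed_segment_real_eq[of x y] assms
    by (simp add: closed_segment_eq_real_ivl mult.commute add.commute)
  finally show ?thesis by auto
qed

text \<open>The difference of the two heights is a sum of three products of nonnegative factors. If it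
  vanishes, then all three products do.\<close>

lemma nested_parabolas_meet_at_ends:
  fixes x y x' y' t :: real
  assumes "x \<le> x'" "y' \<le> y" "x' \<le> t" "t \<le> y'"
    and eq: "(t - x) * (y - t) = (t - x') * (y' - t)" and ne: "(x, y) \<noteq> (x', y')"
  shows "t \<in> {x, y} \<and> t \<in> {x', y'}"
proof -
  have "(t - x') * (y - y') + (x' - x) * (y' - t) + (x' - x) * (y - y') = 0"
    using eq by (simp add: algebra_simps)
  moreover have "0 \<le> (t - x') * (y - y')" "0 \<le> (x' - x) * (y' - t)" "0 \<le> (x' - x) * (y - y')"
    using assms by simp_all
  ultimately have "(t - x') * (y - y') = 0" "(x' - x) * (y' - t) = 0" "(x' - x) * (y - y') = 0"
    by linarith+
  then show ?thesis using ne by auto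
qed

lemma parabolas_meet_at_ends:
  fixes x y x' y' t :: real
  assumes t: "x \<le> t" "t \<le> y" "x' \<le> t" "t \<le> y'"
    and eq: "(t - x) * (y - t) = (t - x') * (y' - t)" and ne: "(x, y) \<noteq> (x', y')"
    and nc: "\<not> (x < x' \<and> x' < y \<and> y < y')" "\<not> (x' < x \<and> x < y' \<and> y' < y)"
  shows "t \<in> {x, y} \<and> t \<in> {x', y'}"
proof -
  consider "x \<le> x'" "y' \<le> y" | "x' \<le> x" "y \<le> y'" | "y \<le> x'" | "y' \<le> x"
    using nc by linarith
  then show ?thesis
  proof cases
    case 1
    then show ?thesis using nested_parabolas_meet_at_ends[OF _ _ t(3,4) eq ne] by blast
  next
    case 2
    then show ?thesis using nested_parabolas_meet_at_ends[OF _ _ t(1,2) eq[symmetric]] ne by auto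
  next
    case 3
    then show ?thesis using t by simp
  next
    case 4
    then show ?thesis using t by simp
  qed
qed

lemma book_thickness_le_pages:
  fixes H :: "'v ugraph"
  assumes simple: "simple_graph H" and inj: "inj_on pos (verts H)"
    and n: "1 \<le> n" and pg: "\<And>e. e \<in> edges H \<Longrightarrow> pg e < n"
    and nc: "\<And>e e'. e \<in> edges H \<Longrightarrow> e' \<in> edges H \<Longrightarrow> pg e = pg e' \<Longrightarrow> \<not> interleaved pos e e'"
  shows "book_thickness H \<le> enat n"
proof -
  define lo where "lo e = real (Min (pos ` e))" for e
  define hi where "hi e = real (Max (pos ` e))" for e
  define D :: "('v, real^3) drawing" where
    "D = \<lparr>vpoint = (\<lambda>v. page_point 0 (pos v) 0), epath = (\<lambda>e. parabola (pg e) (lo e) (hi e))\<rparr>"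
  have vp: "vpoint D v = page_point 0 (pos v) 0" for v by (simp add: D_def)
  have ep: "epath D e = parabola (pg e) (lo e) (hi e)" for e by (simp add: D_def)
  have sub: "e \<subseteq> verts H" if "e \<in> edges H" for e
    using simple that by (simp add: simple_graph_def)
  have two: "\<exists>u v. e = {u, v} \<and> lo e = pos u \<and> hi e = pos v \<and> pos u < pos v" if e: "e \<in> edges H" for e
  proof -
    have "card e = 2" using simple e by (simp add: simple_graph_def)
    then obtain u v where uv: "e = {u, v}" "u \<noteq> v" by (auto simp: card_2_iff)
    then have "pos u \<noteq> pos v" using sub[OF e] inj by (auto dest: inj_onD)
    then consider "pos u < pos v" | "pos v < pos u" by linarith
    then show ?thesis
    proof cases
      case 1
      then show ?thesis using uv by (intro exI[of _ u] exI[of _ v]) (simp add: lo_def hi_def)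
    next
      case 2
      then show ?thesis using uv by (intro exI[of _ v] exI[of _ u]) (auto simp: lo_def hi_def)
    qed
  qed
  have lohi: "lo e < hi e" and ends: "real ` pos ` e = {lo e, hi e}" if "e \<in> edges H" for e
    using two[OF that] by auto
  have vpe: "vpoint D ` e = {page_point 0 (lo e) 0, page_point 0 (hi e) 0}" if "e \<in> edges H" for e
  proof -
    have "vpoint D ` e = (\<lambda>z. page_point 0 z 0) ` real ` pos ` e" by (simp add: vp image_image)
    then show ?thesis by (simp add: ends[OF that])
  qed
  have im: "eimage D e = {page_point (pg e) z ((z - lo e) * (hi e - z)) | z. lo e \<le> z \<and> z \<le> hi e}"
    if "e \<in> edges H" for e
    using path_image_parabola[of "lo e" "hi e" "pg e"] lohi[OF that] by (simp add: eimage_def ep)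
  have on_page: "eimage D e \<subseteq> page (pg e)" if "e \<in> edges H" for e
    unfolding im[OF that] page_def by fastforce
  have arcs: "arc (epath D e)" "{pathstart (epath D e), pathfinish (epath D e)} = vpoint D ` e"
    if "e \<in> edges H" for e
    using lohi[OF that] by (simp_all add: ep arc_parabola parabola_ends vpe[OF that])
  have vpe_sub: "vpoint D ` e \<subseteq> eimage D e" if "e \<in> edges H" for e
    unfolding eimage_def arcs(2)[OF that, symmetric]
    by (simp add: pathstart_in_path_image pathfinish_in_path_image)
  have vinj: "inj_on (vpoint D) (verts H)"
    using inj by (auto simp: inj_on_def vp page_point_eq_iff)
  have meet_verts: "eimage D e \<inter> vpoint D ` verts H = vpoint D ` e" if e: "e \<in> edges H" for e
  proof
    show "eimage D e \<inter> vpoint D ` verts H \<subseteq> vpoint D ` e"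
      unfolding im[OF e] vpe[OF e] by (auto simp: vp page_point_eq_iff)
    show "vpoint D ` e \<subseteq> eimage D e \<inter> vpoint D ` verts H"
      using vpe_sub[OF e] sub[OF e] by blast
  qed
  have meet: "eimage D e \<inter> eimage D e' = vpoint D ` (e \<inter> e')"
    if e: "e \<in> edges H" and e': "e' \<in> edges H" and ne: "e \<noteq> e'" for e e'
  proof
    have vint: "vpoint D ` (e \<inter> e') = vpoint D ` e \<inter> vpoint D ` e'"
      by (rule inj_on_image_Int[OF vinj sub[OF e] sub[OF e']])
    show "vpoint D ` (e \<inter> e') \<subseteq> eimage D e \<inter> eimage D e'"
      unfolding vint using vpe_sub e e' by blast
    show "eimage D e \<inter> eimage D e' \<subseteq> vpoint D ` (e \<inter> e')"
    proof
      fix p assume "p \<in> eimage D e \<inter> eimage D e'"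
      then obtain z where p: "p = page_point (pg e) z ((z - lo e) * (hi e - z))"
        and z: "lo e \<le> z" "z \<le> hi e" "lo e' \<le> z" "z \<le> hi e'"
        and eq: "(z - lo e) * (hi e - z) = (z - lo e') * (hi e' - z)"
        and pgs: "(z - lo e) * (hi e - z) = 0 \<or> pg e = pg e'"
        unfolding im[OF e] im[OF e'] by (auto simp: page_point_eq_iff)
      have "z \<in> {lo e, hi e} \<and> z \<in> {lo e', hi e'}"
      proof (cases "pg e = pg e'")
        case True
        obtain u v where uv: "e = {u, v}" "lo e = pos u" "hi e = pos v" using two[OF e] by blast
        obtain u' v' where uv': "e' = {u', v'}" "lo e' = pos u'" "hi e' = pos v'"
          using two[OF e'] by blast
        have "\<not> interleaved pos e e'" "\<not> interleaved pos e' e" using nc True e e' by simp_all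
        then have nc': "\<not> (lo e < lo e' \<and> lo e' < hi e \<and> hi e < hi e')"
          "\<not> (lo e' < lo e \<and> lo e < hi e' \<and> hi e' < hi e)"
          unfolding interleaved_def uv(2,3) uv'(2,3) of_nat_less_iff using uv(1) uv'(1) by blast+
        have "pos ` e \<noteq> pos ` e'"
          using ne inj_on_image_eq_iff[OF inj sub[OF e] sub[OF e']] by simp
        then have "real ` pos ` e \<noteq> real ` pos ` e'" by (simp add: inj_image_eq_iff)
        then have "(lo e, hi e) \<noteq> (lo e', hi e')" by (auto simp: ends[OF e] ends[OF e'])
        then show ?thesis using z eq nc' by (intro parabolas_meet_at_ends) auto
      next
        case False
        then have "(z - lo e) * (hi e - z) = 0" "(z - lo e') * (hi e' - z) = 0"
          using pgs eq by simp_all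
        then show ?thesis by auto
      qed
      then have "p = page_point 0 z 0" "z \<in> {lo e, hi e}" "z \<in> {lo e', hi e'}"
        using p by (auto simp: page_point_eq_iff)
      then show "p \<in> vpoint D ` (e \<inter> e')" unfolding vint vpe[OF e] vpe[OF e'] by auto
    qed
  qed
  have on_spine: "vpoint D ` verts H \<subseteq> spine" by (auto simp: vp spine_def)
  have "graph_image H D \<subseteq> spine \<union> \<Union> (page ` {..<n})"
    unfolding graph_image_def using on_spine on_page pg by blast
  then have "embeds_in H (spine \<union> \<Union> (page ` {..<n})) D"
    unfolding embeds_in_def using vinj arcs meet_verts meet by simp
  moreover have "eimage D e - vpoint D ` e \<subseteq> rel_interior (page (pg e))" if e: "e \<in> edges H" for e
  proof
    fix p assume "p \<in> eimage D e - vpoint D ` e"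
    then obtain z where z: "p = page_point (pg e) z ((z - lo e) * (hi e - z))" "lo e \<le> z" "z \<le> hi e"
        "p \<notin> vpoint D ` e" unfolding im[OF e] by blast
    then have "z \<noteq> lo e" "z \<noteq> hi e" by (auto simp: vpe[OF e] page_point_eq_iff)
    then show "p \<in> rel_interior (page (pg e))"
      using z by (simp add: page_point_rel_interior)
  qed
  ultimately have "book_embedding H spine (page ` {..<n}) D"
    unfolding book_embedding_def using on_spine pg by blast
  then show ?thesis
    unfolding book_thickness_def using is_book_pages[OF n] by (intro Inf_lower) blast
qed

section \<open>Levels of a Hamiltonian diagram as pages\<close>

definition complex_of_vec :: "real^2 \<Rightarrow> complex" where
  "complex_of_vec v = Complex (v $ 1) (v $ 2)"

definition vec_of_complex :: "complex \<Rightarrow> real^2" where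
  "vec_of_complex z = vector [Re z, Im z]"

lemma vec_of_complex_inverse:
  "vec_of_complex (complex_of_vec v) = v" "complex_of_vec (vec_of_complex z) = z"
  by (simp_all add: complex_of_vec_def vec_of_complex_def vec_eq_iff forall_2)

lemma linear_complex_of_vec: "linear complex_of_vec"
  by (rule linearI) (simp_all add: complex_of_vec_def complex_eq_iff)

lemma linear_vec_of_complex: "linear vec_of_complex"
  by (rule linearI) (simp_all add: vec_of_complex_def vec_eq_iff forall_2)

text \<open>This leaves no vertex strictly between the ends of a cycle edge, or none outside them, so that
  a cycle edge alternates with no other edge.\<close>

lemma cycle_edge_consecutive:
  assumes c: "distinct c" and e: "{c ! i, c ! j} \<in> cycle_edges c" and ij: "i < j" "j < length c"
  shows "j = Suc i \<or> (i = 0 \<and> Suc j = length c)"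
proof -
  let ?n = "length c"
  obtain m where m: "m < ?n" "{c ! i, c ! j} = {c ! m, c ! (Suc m mod ?n)}"
    using e by (auto simp: cycle_edges_def)
  have "Suc m mod ?n < ?n" using ij by (intro mod_less_divisor) linarith
  then have "i = m \<and> j = Suc m mod ?n \<or> i = Suc m mod ?n \<and> j = m"
    using m ij c by (auto simp: doubleton_eq_iff nth_eq_iff_index_eq)
  then show ?thesis using m(1) ij by (cases "Suc m = ?n") auto
qed

lemma interleaved_chords_on_different_pages:
  fixes D :: "('v, space3) drawing"
  assumes simple: "simple_graph H" and lev: "leveled_diagram H D c n"
    and inj: "inj_on fst (graph_image (page_graph H c pg (pg e)) D)"
    and e: "e = {c ! i, c ! j}" "e \<in> edges H" and e': "e' = {c ! k, c ! l}" "e' \<in> edges H"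
    and ord: "i < k" "k < j" "j < l" "l < length c"
  shows "pg e \<noteq> pg e'"
proof
  assume pg: "pg e = pg e'"
  let ?S = "page_graph H c pg (pg e)" and ?C = "cycle_image D c"
  let ?D = "map_drawing complex_of_vec (map_drawing fst D)"
  have semi: "semi_leveled_diagram H D c" using lev by (simp add: leveled_diagram_def)
  then have cyc: "is_cycle H c" by (simp add: semi_leveled_diagram_def)
  have emb: "embeds_in H UNIV D"
    using semi by (simp add: semi_leveled_diagram_def is_diagram_def polygonal_embedding_def)
  have "embeds_in ?S UNIV (map_drawing fst D)" by (rule page_graph_planar[OF simple emb inj])
  then have "embeds_in ?S UNIV ?D"
  proof (rule embeds_in_map_drawing)
    show "simple_graph ?S" using simple by (auto simp: simple_graph_def)
    show "continuous_on (graph_image ?S (map_drawing fst D)) complex_of_vec"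
      using linear_complex_of_vec by (intro linear_continuous_on) (simp add: linear_conv_bounded_linear)
    show "inj_on complex_of_vec (graph_image ?S (map_drawing fst D))"
      by (rule inj_on_inverseI) (rule vec_of_complex_inverse)
  qed
  moreover have "is_cycle ?S c" using cyc by (auto simp: is_cycle_def)
  moreover have off: "e \<notin> cycle_edges c" "e' \<notin> cycle_edges c"
    using cycle_edge_consecutive[of c i j] cycle_edge_consecutive[of c k l] ord cyc e(1) e'(1)
    by (auto simp: is_cycle_def)
  moreover have "eimage ?D x - vpoint ?D ` x \<subseteq> inside (cycle_image ?D c)"
    if x: "x \<in> edges H" "x \<notin> cycle_edges c" for x
  proof -
    obtain A where A: "A \<in> fragments H D c" "eimage D x \<subseteq> A"
      using edge_in_fragment[OF emb cyc x] by blast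
    then have "eimage D x - vpoint D ` x \<subseteq> A - ?C"
      using open_edge_disjoint_spine[OF emb cyc x] by blast
    moreover have "fst ` (A - ?C) \<subseteq> inside (fst ` ?C)"
      using lev A(1) by (simp add: leveled_diagram_def)
    ultimately have "complex_of_vec ` fst ` (eimage D x - vpoint D ` x)
        \<subseteq> complex_of_vec ` inside (fst ` ?C)" by blast
    also have "\<dots> \<subseteq> inside (complex_of_vec ` fst ` ?C)"
      by (rule inside_linear_image[OF linear_complex_of_vec linear_vec_of_complex vec_of_complex_inverse])
    finally have "complex_of_vec ` fst ` (eimage D x - vpoint D ` x) \<subseteq> inside (cycle_image ?D c)"
      by (simp add: cycle_image_map_drawing)
    moreover have "eimage ?D x - vpoint ?D ` x \<subseteq> complex_of_vec ` fst ` (eimage D x - vpoint D ` x)"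
      using image_diff_subset[of "complex_of_vec \<circ> fst" "eimage D x" "vpoint D ` x"]
      by (simp add: image_image)
    ultimately show ?thesis by blast
  qed
  ultimately show False
    using interleaved_chords_cross[of ?S UNIV ?D c i j k l] e e' pg ord by auto
qed

lemma book_thickness_le_levels:
  assumes simple: "simple_graph H" and ham: "is_hamiltonian_cycle H c"
    and lev: "leveled_diagram H D c n"
  shows "book_thickness H \<le> enat n"
proof -
  obtain pg where n: "1 \<le> n" and pg: "\<And>e. e \<in> edges H \<Longrightarrow> pg e < n"
    and inj: "\<And>i. i < n \<Longrightarrow> inj_on fst (graph_image (page_graph H c pg i) D)"
    using leveled_diagram_pages[OF lev] by blast
  have dist: "distinct c" and V: "set c = verts H"
    using ham by (auto simp: is_hamiltonian_cycle_def is_cycle_def)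
  define pos where "pos = the_inv_into {..<length c} ((!) c)"
  have bij: "bij_betw ((!) c) {..<length c} (verts H)"
    using bij_betw_nth[OF dist] V by simp
  then have posinj: "inj_on pos (verts H)"
    unfolding pos_def using bij_betw_the_inv_into bij_betw_imp_inj_on by blast
  have idx: "pos v < length c" "c ! pos v = v" if "v \<in> verts H" for v
  proof -
    have "pos v \<in> {..<length c}"
      unfolding pos_def using bij_betw_the_inv_into[OF bij] that by (metis bij_betwE)
    then show "pos v < length c" by simp
    show "c ! pos v = v"
      unfolding pos_def using f_the_inv_into_f_bij_betw[OF bij] that by blast
  qed
  show ?thesis
  proof (rule book_thickness_le_pages[OF simple posinj n pg])
    fix e e' assume e: "e \<in> edges H" and e': "e' \<in> edges H" and eq: "pg e = pg e'"
    show "\<not> interleaved pos e e'"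
    proof
      assume "interleaved pos e e'"
      then obtain u v u' v' where uv: "e = {u, v}" "e' = {u', v'}"
        and ord: "pos u < pos u'" "pos u' < pos v" "pos v < pos v'"
        unfolding interleaved_def by blast
      have "e \<subseteq> verts H" "e' \<subseteq> verts H" using simple e e' by (auto simp: simple_graph_def)
      then have "u \<in> verts H" "v \<in> verts H" "u' \<in> verts H" "v' \<in> verts H" using uv by auto
      then have "e = {c ! pos u, c ! pos v}" "e' = {c ! pos u', c ! pos v'}" "pos v' < length c"
        using uv idx by simp_all
      then show False
        using interleaved_chords_on_different_pages[OF simple lev inj[OF pg[OF e]] _ e _ e' ord] eq
        by blast
    qed
  qed
qed

theorem proposition6:
  fixes G :: "'a ugraph" and H :: "'b ugraph"
  assumes "simple_graph G" and "connected_graph G"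
    and "simple_graph H" and "connected_graph H" and "hamiltonian_graph H"
  shows "thickness G \<le> graph_level_number G \<and>
         book_thickness H \<le> graph_ham_level_number H"
proof
  show "thickness G \<le> graph_level_number G"
    unfolding graph_level_number_def level_number_def
    by (intro INF_greatest Inf_greatest) (use thickness_le_levels[OF assms(1)] in auto)
  show "book_thickness H \<le> graph_ham_level_number H"
    unfolding graph_ham_level_number_def ham_level_number_def
    by (intro INF_greatest Inf_greatest) (use book_thickness_le_levels[OF assms(3)] in auto)
qed

end
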